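(* Let $a$, $b$, $n$ be complex parameters with $a+n+1\notin\{0,-1,-2,\ldots\}$ and $b+n+1\notin\{0,-1,-2,\ldots\}$, and let $$ f(n)=\sum_{k=0}^{\infty}\frac{(-1)^k\,(a)_k\,(b)_k}{(a+n+1)_k\,(b+n+1)_k}. $$ If the series $f(n)$ and $f(n+2)$ converge, then $$ f(n) = \frac{a(3+2b+3n)+(1+n)(6+3b+5n)}{4(1+a+n)(1+b+n)} + \frac{(-2+a-b-n)(1+n)(2+n)(2+a-b+n)}{4(1+a+n)(2+a+n)(1+b+n)(2+b+n)}\, f(n+2). $$
   Context: For a complex number $x$ and an integer $k\ge 0$, $(x)_k = x(x+1)\cdots(x+k-1)$ denotes the Pochhammer symbol (rising factorial), with $(x)_0=1$. Here $f(n+2)$ is the same series with $n$ replaced by $n+2$ and with $a,b$ unchanged, i.e. $f(n+2)=\sum_{k\ge 0}(-1)^k(a)_k(b)_k/\bigl((a+n+3)_k(b+n+3)_k\bigr)$. *)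

theory Defs
  imports Complex_Main "HOL-Library.Nonpos_Ints"
begin

definition f_term :: "complex \<Rightarrow> complex \<Rightarrow> complex \<Rightarrow> nat \<Rightarrow> complex" where
  "f_term a b n k =
     (-1) ^ k * pochhammer a k * pochhammer b k
       / (pochhammer (a + n + 1) k * pochhammer (b + n + 1) k)"

definition f_series :: "complex \<Rightarrow> complex \<Rightarrow> complex \<Rightarrow> complex" where
  "f_series a b n = (\<Sum>k. f_term a b n k)"

end

theory Submission
  imports Defs
begin

text \<open>
  The recurrence is a telescoping identity. With \<open>c = a + n + 1\<close> and \<open>d = b + n + 1\<close>, the sequence
  \<open>G k = f_term a b n k * R k\<close>, where
  \<open>R k = - (2 + (n + 1) * (1 / (c + k) + 1 / (d + k)) + (n + 1) * (n + 2) / ((c + k) * (d + k))) / 4\<close>,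
  satisfies
  \<open>f_term a b n k - B * f_term a b (n + 2) k = G (k + 1) - G k\<close>
  for the coefficient \<open>B\<close> of the shifted series (lemma \<open>f_term_telescoping\<close>). Summing over \<open>k\<close>
  leaves \<open>lim G - G 0\<close>. Since \<open>R k\<close> tends to \<open>- 1 / 2\<close> and the terms of a convergent series tend
  to \<open>0\<close>, the limit vanishes (lemma \<open>certificate_tendsto_0\<close>), and \<open>- G 0\<close> is the rational
  inhomogeneous part.

  The certificate is the result of Gosper's ansatz. Both \<open>f_term a b n (k + 1) / f_term a b n k\<close> and
  \<open>f_term a b (n + 2) k / f_term a b n k\<close> are rational in \<open>k\<close>, so putting
  \<open>R k = P k / ((c + k) * (d + k))\<close> and clearing denominators turns the telescoping condition into
  \<open>- P (k + 1) * (a + k) * (b + k) - P k * (c + k + 1) * (d + k + 1)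
    = (c + k) * (c + k + 1) * (d + k) * (d + k + 1) - B * c * (c + 1) * d * (d + 1)\<close>.
  The right-hand side has degree four in \<open>k\<close>, so \<open>P\<close> is quadratic, and comparing coefficients
  determines \<open>P\<close> from the three highest powers and \<open>B\<close> from the constant term, and the linear
  coefficients then agree. The partial fraction expansion of the quotient is the formula for \<open>R\<close>.
\<close>

lemma add_of_nat_nonzero:
  fixes c :: complex
  assumes "c \<notin> \<int>\<^sub>\<le>\<^sub>0"
  shows "c + of_nat k \<noteq> 0"
proof
  assume "c + of_nat k = 0"
  hence "c = - of_nat k" by (simp add: eq_neg_iff_add_eq_0)
  with assms show False by simp
qed

lemma pochhammer_add_2:
  fixes c :: "'a :: comm_ring_1"
  shows "c * (c + 1) * pochhammer (c + 2) k
       = pochhammer c k * ((c + of_nat k) * (c + of_nat k + 1))"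
proof -
  have "pochhammer c (2 + k) = pochhammer c (k + 2)" by (simp only: add.commute)
  thus ?thesis
    unfolding pochhammer_product' by (simp add: pochhammer_rec numeral_2_eq_2 algebra_simps)
qed

lemma f_term_Suc:
  "f_term a b n (Suc k) =
     - f_term a b n k * ((a + of_nat k) * (b + of_nat k))
       / ((a + n + 1 + of_nat k) * (b + n + 1 + of_nat k))"
  by (simp add: f_term_def pochhammer_Suc mult_ac)

lemma f_term_shift_2:
  assumes "a + n + 1 \<notin> \<int>\<^sub>\<le>\<^sub>0" and "b + n + 1 \<notin> \<int>\<^sub>\<le>\<^sub>0"
  defines "c \<equiv> a + n + 1" and "d \<equiv> b + n + 1"
  shows "f_term a b (n + 2) k =
     f_term a b n k * (c * (c + 1) * (d * (d + 1)))
       / ((c + of_nat k) * (c + of_nat k + 1) * ((d + of_nat k) * (d + of_nat k + 1)))"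
proof -
  have c: "c \<notin> \<int>\<^sub>\<le>\<^sub>0" and d: "d \<notin> \<int>\<^sub>\<le>\<^sub>0" using assms by simp_all
  have shift: "pochhammer (x + 2) k =
      pochhammer x k * ((x + of_nat k) * (x + of_nat k + 1)) / (x * (x + 1))"
    and nz: "x * (x + 1) \<noteq> 0"
    if "x \<notin> \<int>\<^sub>\<le>\<^sub>0" for x :: complex
  proof -
    show "x * (x + 1) \<noteq> 0"
      using add_of_nat_nonzero[OF that, of 0] add_of_nat_nonzero[OF that, of 1] by simp
    thus "pochhammer (x + 2) k =
        pochhammer x k * ((x + of_nat k) * (x + of_nat k + 1)) / (x * (x + 1))"
      using pochhammer_add_2[of x k] by (simp add: eq_divide_eq mult_ac)
  qed
  have params: "a + (n + 2) + 1 = c + 2" "b + (n + 2) + 1 = d + 2"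
    by (simp_all add: c_def d_def)
  show ?thesis
    unfolding f_term_def params c_def[symmetric] d_def[symmetric] shift[OF c] shift[OF d]
    by (simp add: mult_ac)
qed

definition certificate :: "complex \<Rightarrow> complex \<Rightarrow> complex \<Rightarrow> nat \<Rightarrow> complex" where
  "certificate a b n k = - (2
      + (n + 1) * (1 / (a + n + 1 + of_nat k) + 1 / (b + n + 1 + of_nat k))
      + (n + 1) * (n + 2) * (1 / (a + n + 1 + of_nat k) * (1 / (b + n + 1 + of_nat k)))) / 4"

definition shift_coeff :: "complex \<Rightarrow> complex \<Rightarrow> complex \<Rightarrow> complex" where
  "shift_coeff a b n =
     ((- 2 + a - b - n) * (1 + n) * (2 + n) * (2 + a - b + n))
        / (4 * (1 + a + n) * (2 + a + n) * (1 + b + n) * (2 + b + n))"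

text \<open>
  Both sides are multiples of \<open>f_term a b n k\<close> by rational functions of \<open>k\<close>. Clearing denominators,
  equality of these cofactors is the identity \<open>poly\<close> below, where \<open>u = c + k\<close> and \<open>v = d + k\<close>; in these variables
  \<open>a + k = u - n - 1\<close>, \<open>b + k = v - n - 1\<close> and \<open>a - b = u - v\<close>, so that \<open>k\<close> disappears.
\<close>
lemma f_term_telescoping:
  assumes "a + n + 1 \<notin> \<int>\<^sub>\<le>\<^sub>0" and "b + n + 1 \<notin> \<int>\<^sub>\<le>\<^sub>0"
  shows "f_term a b n k - shift_coeff a b n * f_term a b (n + 2) k
       = f_term a b n (Suc k) * certificate a b n (Suc k) - f_term a b n k * certificate a b n k"
proof -
  define c d where "c = a + n + 1" and "d = b + n + 1"
  define u v t where "u = c + of_nat k" and "v = d + of_nat k" and "t = f_term a b n k"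
  have c: "c \<notin> \<int>\<^sub>\<le>\<^sub>0" and d: "d \<notin> \<int>\<^sub>\<le>\<^sub>0" using assms by (simp_all add: c_def d_def)
  have nz: "c \<noteq> 0" "c + 1 \<noteq> 0" "d \<noteq> 0" "d + 1 \<noteq> 0"
    "u \<noteq> 0" "u + 1 \<noteq> 0" "v \<noteq> 0" "v + 1 \<noteq> 0"
    using add_of_nat_nonzero[OF c, of 0] add_of_nat_nonzero[OF c, of 1]
      add_of_nat_nonzero[OF d, of 0] add_of_nat_nonzero[OF d, of 1]
      add_of_nat_nonzero[OF c, of k] add_of_nat_nonzero[OF c, of "Suc k"]
      add_of_nat_nonzero[OF d, of k] add_of_nat_nonzero[OF d, of "Suc k"]
    by (simp_all add: u_def v_def add_ac)
  define D where "D = c * (c + 1) * (d * (d + 1))"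
  define N where "N = (u - v - n - 2) * (n + 1) * (n + 2) * (u - v + n + 2)"
  define Q where "Q = (\<lambda>x y :: complex. 2 * x * y + (n + 1) * (x + y) + (n + 1) * (n + 2))"

  have D_nz: "D \<noteq> 0" using nz by (simp add: D_def)
  have coeff: "shift_coeff a b n = N / (4 * D)"
    unfolding D_def shift_coeff_def N_def c_def d_def u_def v_def by (simp add: algebra_simps)
  have "f_term a b (n + 2) k = t * D / (u * (u + 1) * (v * (v + 1)))"
    using f_term_shift_2[OF assms, of k] unfolding D_def c_def d_def u_def v_def t_def .
  hence shifted: "shift_coeff a b n * f_term a b (n + 2) k
      = t * N / (4 * (u * (u + 1) * (v * (v + 1))))"
    unfolding coeff using D_nz by (simp add: D_def[symmetric] mult_ac)
  have succ: "f_term a b n (Suc k) = - t * ((u - n - 1) * (v - n - 1)) / (u * v)"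
    unfolding f_term_Suc c_def d_def u_def v_def t_def by simp
  have cert_at: "certificate a b n m = - Q x y / (4 * (x * y))"
    if "x = c + of_nat m" "y = d + of_nat m" "x \<noteq> 0" "y \<noteq> 0" for m x y
    using that(3,4) unfolding certificate_def Q_def c_def[symmetric] d_def[symmetric]
      that(1,2)[symmetric] by (simp add: field_simps)
  have cert: "certificate a b n k = - Q u v / (4 * (u * v))"
    using nz by (intro cert_at) (simp_all add: u_def v_def)
  have cert_Suc: "certificate a b n (Suc k) = - Q (u + 1) (v + 1) / (4 * ((u + 1) * (v + 1)))"
    using nz by (intro cert_at) (simp_all add: u_def v_def add_ac)

  have poly: "4 * (u * (u + 1) * (v * (v + 1))) - N
      = (u - n - 1) * (v - n - 1) * Q (u + 1) (v + 1) + Q u v * ((u + 1) * (v + 1))"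
    unfolding N_def Q_def by algebra
  have "t - t * N / (4 * (u * (u + 1) * (v * (v + 1))))
      = t * (4 * (u * (u + 1) * (v * (v + 1))) - N) / (4 * (u * (u + 1) * (v * (v + 1))))"
    using nz by (simp add: diff_divide_distrib right_diff_distrib)
  also have "\<dots> = (- t * ((u - n - 1) * (v - n - 1)) / (u * v))
        * (- Q (u + 1) (v + 1) / (4 * ((u + 1) * (v + 1)))) - t * (- Q u v / (4 * (u * v)))"
  proof -
    have split: "t * (x * p' + p * e) / (4 * (m * e))
        = (- t * x / m) * (- p' / (4 * e)) - t * (- p / (4 * m))"
      if "m \<noteq> 0" "e \<noteq> 0" for x p p' m e :: complex
      using that by (simp add: field_simps)
    have "u * (u + 1) * (v * (v + 1)) = (u * v) * ((u + 1) * (v + 1))" by (simp only: mult_ac)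
    thus ?thesis
      unfolding poly using nz by (simp only: split mult_eq_0_iff simp_thms)
  qed
  finally show ?thesis
    unfolding shifted succ cert cert_Suc t_def .
qed

text \<open>The certificate converges, so it cannot spoil the convergence of the terms to zero.\<close>
lemma certificate_tendsto_0:
  assumes "summable (f_term a b n)"
  shows "(\<lambda>k. f_term a b n k * certificate a b n k) \<longlonglongrightarrow> 0"
proof -
  have inv: "(\<lambda>k. 1 / (c + of_nat k)) \<longlonglongrightarrow> 0" for c :: complex
    by (rule tendsto_divide_0[OF tendsto_const])
       (rule tendsto_add_filterlim_at_infinity[OF tendsto_const tendsto_of_nat])
  have "certificate a b n \<longlonglongrightarrow>
      - (2 + (n + 1) * (0 + 0) + (n + 1) * (n + 2) * (0 * 0)) / 4"
    unfolding certificate_def by (intro tendsto_intros inv) auto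
  with summable_LIMSEQ_zero[OF assms] show ?thesis
    using tendsto_mult by fastforce
qed

theorem theorem4p39:
  fixes a b n :: complex
  assumes "a + n + 1 \<notin> \<int>\<^sub>\<le>\<^sub>0"
    and "b + n + 1 \<notin> \<int>\<^sub>\<le>\<^sub>0"
    and "summable (f_term a b n)"
    and "summable (f_term a b (n + 2))"
  shows "f_series a b n =
      (a * (3 + 2 * b + 3 * n) + (1 + n) * (6 + 3 * b + 5 * n))
        / (4 * (1 + a + n) * (1 + b + n))
      + ((- 2 + a - b - n) * (1 + n) * (2 + n) * (2 + a - b + n))
        / (4 * (1 + a + n) * (2 + a + n) * (1 + b + n) * (2 + b + n))
        * f_series a b (n + 2)"
proof -
  have "(\<lambda>k. f_term a b n k - shift_coeff a b n * f_term a b (n + 2) k)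
      sums (f_series a b n - shift_coeff a b n * f_series a b (n + 2))"
    unfolding f_series_def
    by (intro sums_diff sums_mult summable_sums assms)
  moreover have "(\<lambda>k. f_term a b n k - shift_coeff a b n * f_term a b (n + 2) k)
      sums (0 - f_term a b n 0 * certificate a b n 0)"
    unfolding f_term_telescoping[OF assms(1,2)]
    by (rule telescope_sums[OF certificate_tendsto_0[OF assms(3)]])
  ultimately have "f_series a b n - shift_coeff a b n * f_series a b (n + 2)
      = - certificate a b n 0"
    by (simp add: sums_unique2 f_term_def)
  moreover have "- certificate a b n 0 =
      (a * (3 + 2 * b + 3 * n) + (1 + n) * (6 + 3 * b + 5 * n))
        / (4 * (1 + a + n) * (1 + b + n))"
  proof -
    define x y where "x = 1 + a + n" and "y = 1 + b + n"
    have nz: "x \<noteq> 0" "y \<noteq> 0"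
      using add_of_nat_nonzero[OF assms(1), of 0] add_of_nat_nonzero[OF assms(2), of 0]
      by (simp_all add: x_def y_def add_ac)
    have xy: "a + n + 1 + of_nat 0 = x" "b + n + 1 + of_nat 0 = y"
      by (simp_all add: x_def y_def)
    have "- certificate a b n 0
        = (2 * x * y + (n + 1) * (x + y) + (n + 1) * (n + 2)) / (4 * x * y)"
      using nz unfolding certificate_def xy by (simp add: field_simps)
    also have "2 * x * y + (n + 1) * (x + y) + (n + 1) * (n + 2)
        = a * (3 + 2 * b + 3 * n) + (1 + n) * (6 + 3 * b + 5 * n)"
      unfolding x_def y_def by algebra
    finally show ?thesis unfolding x_def y_def .
  qed
  ultimately show ?thesis
    unfolding shift_coeff_def by (simp add: diff_eq_eq)
qed

end
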